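(* Let $\Omega\subseteq\mathbb{R}^2$ be bounded and let $\{P^i\}_{i=1}^d$ be a connected polytope partition of $\Omega$. Let $\mathcal{V}:=\bigcup_{i=1}^d\mathrm{ext}(P^i)$ and $\mathcal{S}:=\{S^i\}_{i=1}^d$ where $S^i=\mathcal{V}\cap P^i$. Then the formulation (F1) for $\mathrm{CDC}(\mathcal{S})$ given in the context uses $2(d-1)$ fewer continuous variables than the formulation (F2), and $2(d-1)$ fewer than the formulation (F3), given in the context.
   Context: A polytope is a bounded polyhedron, and $\mathrm{ext}(P)$ is its set of extreme points. Polytope partition of $\Omega$: polytopes $P^1,\dots,P^d$ with $\Omega=\bigcup_{i=1}^dP^i$ and $\mathrm{relint}(P^i)\cap\mathrm{relint}(P^j)=\emptyset$ for $i\ne j$. Its dual graph has vertex set $\{P^i\}_{i=1}^d$, with $P^i$ adjacent to $P^j$ iff $|P^i\cap P^j|=\infty$. The partition is connected if the dual graph is connected. For a finite collection $\mathcal{S}=\{S^i\}_{i=1}^d$ of finite sets with $J=\bigcup_iS^i$, let $\Delta^J=\{\lambda\in\mathbb{R}^J_{\ge0}:\sum_{v\in J}\lambda_v=1\}$ and $\mathrm{CDC}(\mathcal{S}):=\bigcup_{S\in\mathcal{S}}\{\lambda\in\Delta^J:\lambda_{J\setminus S}=0\}$. The intersection graph $\mathcal{K}_{\mathcal{S}}$ is the complete graph on $\mathcal{S}$; an edge $e=S^iS^j$ has middle set $\mathrm{mid}(e)=S^i\cap S^j$ and weight $|S^i\cap S^j|$. The conflict graph of $\mathrm{CDC}(\mathcal{S})$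 has vertex set $J$, with distinct $u,v$ adjacent iff $\{u,v\}\not\subseteq S$ for all $S\in\mathcal{S}$. A biclique $\{A,B\}$ is the complete bipartite graph with sides $A,B$; a biclique cover of a graph is a collection of biclique subgraphs covering all its edges. Biclique cover procedure, applied to a tree whose vertices are index sets. Separation step: if the tree has at most one vertex, return the empty list. Otherwise choose an edge $e$ whose removal gives subtrees $T_1,T_2$ with $\big||V(T_1)|-|V(T_2)|\big|$ minimal, form the biclique $\{\bigcup_{S\in V(T_1)}S\setminus\mathrm{mid}(e),\ \bigcup_{S\in V(T_2)}S\setminus\mathrm{mid}(e)\}$, and recurse on $T_1$ and $T_2$; return the list consisting of this biclique, then the first elements (if any) of the lists obtained from $T_1$ and $T_2$, then the remaining elements of those two lists. Merging step: start from an empty merged list and go through the bicliques $\{A,B\}$ in order; replace the first $\{A',B'\}$ in the merged list for which $\{A'\cup A,B'\cup B\}$ (or, failing that, $\{A'\cup B,B'\cup A\}$) is a biclique subgraph of the conflict graph by that union, and append $\{A,B\}$ if there is no such $\{A',B'\}$. The merged list is the output. Formulation (F1). Create pairwise disjoint sets $S'^{,1},\dots,S'^{,d}$ of new indices and a map $\alpha$ taking each $S'^{,i}$ bijectively onto $S^i$. Take a maximum spanning tree $\mathcal{T}$ of $\mathcal{K}_{\mathcal{S}}$ and mark $S^1$ as selected. While some vertex is not selected, choose an edge $S^iS^j$ of $\mathcal{T}$ with $S^i$ selected and $S^j$ not; select $S^j$; for all $x\in S'^{,i}$, $y\in S'^{,j}$ with $\alpha(x)=\alpha(y)$ replace $y$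 by $x$ in $S'^{,j}$. Let $\mathcal{S}'=\{S'^{,i}\}_{i=1}^d$ be the final collection, $J'=\bigcup_iS'^{,i}$ (with $\alpha$ restricted to $J'$), $\mathcal{T}'$ the tree obtained from $\mathcal{T}$ by replacing each vertex $S^i$ by $S'^{,i}$, and $\{\{A'^{,j},B'^{,j}\}\}_{j=1}^t$ the biclique cover of the conflict graph of $\mathrm{CDC}(\mathcal{S}')$ output by the procedure applied to $\mathcal{T}'$. (F1) is: $\lambda_v=\sum_{u:\alpha(u)=v}\lambda'_u$ for $v\in J$; $\sum_{v\in A'^{,j}}\lambda'_v\le z_j$, $\sum_{v\in B'^{,j}}\lambda'_v\le1-z_j$, $z_j\in\{0,1\}$ for $j=1,\dots,t$; $\lambda'\in\Delta^{J'}$. Formulation (F2). $\lambda_v=\sum_{S\in\mathcal{S}:v\in S}\gamma^S_v$ for $v\in J$; $\sum_{S\in\mathcal{S}}\sum_{v\in S}\gamma^S_v=1$; $\sum_{S\in\mathcal{S}}\sum_{v\in S}h^S\gamma^S_v=z$; $\gamma^S\ge0$ for $S\in\mathcal{S}$; $z\in\{0,1\}^r$, where $\{h^S\}_{S\in\mathcal{S}}\subseteq\{0,1\}^r$ are distinct binary vectors. Formulation (F3). Let $\mathcal{S}''=\{S''^{,i}\}_{i=1}^d$ be pairwise disjoint sets of new indices, $\alpha''$ a map taking each $S''^{,i}$ bijectively onto $S^i$, $J''=\bigcup_iS''^{,i}$, $\mathcal{T}''$ the path with edges $S''^{,i}S''^{,i+1}$ for $i=1,\dots,d-1$, and $\{\{A''^{,j},B''^{,j}\}\}_{j=1}^{t''}$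 the biclique cover of the conflict graph of $\mathrm{CDC}(\mathcal{S}'')$ output by the procedure applied to $\mathcal{T}''$. (F3) is: $\lambda_v=\sum_{u:\alpha''(u)=v}\lambda''_u$ for $v\in J$; $\sum_{v\in A''^{,j}}\lambda''_v\le z_j$, $\sum_{v\in B''^{,j}}\lambda''_v\le1-z_j$, $z_j\in\{0,1\}$ for $j=1,\dots,t''$; $\lambda''\in\Delta^{J''}$. In counting continuous variables, the $\lambda$ variables are regarded as projected out through the first family of equations in each formulation, so the continuous variables are $\lambda'\in\mathbb{R}^{J'}$ in (F1), the $\gamma^S_v$ in (F2), and $\lambda''\in\mathbb{R}^{J''}$ in (F3).
   Formalization: "2(d-1) fewer" is proved as an exact count when d = 1 or every P^i has nonempty interior, and as "at least 2(d-1) fewer" in general; the exact count fails if a segment piece lies inside the common edge of two polygons. *)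

theory Defs
  imports "HOL-Analysis.Analysis"
begin

section \<open>Simple graphs\<close>

text \<open>A graph is a vertex set together with a set of two-element edges. Families
  of sets are indexed, and the index stands for the set as a vertex.\<close>

definition simple_graph :: "'a set \<Rightarrow> 'a set set \<Rightarrow> bool" where
  "simple_graph V E \<longleftrightarrow> finite V \<and> (\<forall>e\<in>E. e \<subseteq> V \<and> card e = 2)"

definition reach :: "'a set set \<Rightarrow> 'a \<Rightarrow> 'a set" where
  "reach E a = {b. (\<lambda>x y. {x, y} \<in> E)\<^sup>*\<^sup>* a b}"

definition graph_connected :: "'a set \<Rightarrow> 'a set set \<Rightarrow> bool" where
  "graph_connected V E \<longleftrightarrow> (\<forall>u\<in>V. V \<subseteq> reach E u)"

definition graph_cycle :: "'a set set \<Rightarrow> 'a list \<Rightarrow> bool" where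
  "graph_cycle E xs \<longleftrightarrow> 3 \<le> length xs \<and> distinct xs \<and>
     (\<forall>k<length xs. {xs ! k, xs ! (Suc k mod length xs)} \<in> E)"

definition graph_tree :: "'a set \<Rightarrow> 'a set set \<Rightarrow> bool" where
  "graph_tree V E \<longleftrightarrow> V \<noteq> {} \<and> simple_graph V E \<and> graph_connected V E \<and> (\<nexists>xs. graph_cycle E xs)"

definition complete_edges :: "'a set \<Rightarrow> 'a set set" where
  "complete_edges V = {e. e \<subseteq> V \<and> card e = 2}"

definition spanning_tree :: "'a set \<Rightarrow> 'a set set \<Rightarrow> 'a set set \<Rightarrow> bool" where
  "spanning_tree V E T \<longleftrightarrow> T \<subseteq> E \<and> graph_tree V T"

definition max_spanning_tree ::
    "'a set \<Rightarrow> 'a set set \<Rightarrow> ('a set \<Rightarrow> nat) \<Rightarrow> 'a set set \<Rightarrow> bool" where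
  "max_spanning_tree V E w T \<longleftrightarrow> spanning_tree V E T \<and>
     (\<forall>T'. spanning_tree V E T' \<longrightarrow> sum w T' \<le> sum w T)"


section \<open>Polytope partitions\<close>

definition polytope_partition ::
    "'a::euclidean_space set \<Rightarrow> nat \<Rightarrow> (nat \<Rightarrow> 'a set) \<Rightarrow> bool" where
  "polytope_partition \<Omega> d P \<longleftrightarrow>
     (\<forall>i\<in>{1..d}. polytope (P i)) \<and> \<Omega> = (\<Union>i\<in>{1..d}. P i) \<and>
     (\<forall>i\<in>{1..d}. \<forall>j\<in>{1..d}. i \<noteq> j \<longrightarrow> rel_interior (P i) \<inter> rel_interior (P j) = {})"

definition dual_edges :: "nat \<Rightarrow> (nat \<Rightarrow> 'a set) \<Rightarrow> nat set set" where
  "dual_edges d P = {{i, j} | i j. i \<in> {1..d} \<and> j \<in> {1..d} \<and> i \<noteq> j \<and> infinite (P i \<inter> P j)}"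

definition connected_partition :: "nat \<Rightarrow> (nat \<Rightarrow> 'a set) \<Rightarrow> bool" where
  "connected_partition d P \<longleftrightarrow> graph_connected {1..d} (dual_edges d P)"


section \<open>Combinatorial disjunctive constraints\<close>

text \<open>A vector indexed by a set \<open>I\<close> is a function that vanishes outside \<open>I\<close>.\<close>

definition vectors :: "'a set \<Rightarrow> ('a \<Rightarrow> real) set" where
  "vectors I = {x. \<forall>i. i \<notin> I \<longrightarrow> x i = 0}"

definition nonneg_vectors :: "'a set \<Rightarrow> ('a \<Rightarrow> real) set" where
  "nonneg_vectors I = {x \<in> vectors I. \<forall>i\<in>I. 0 \<le> x i}"

definition binary_vectors :: "nat \<Rightarrow> (nat \<Rightarrow> real) set" where
  "binary_vectors r = {z \<in> vectors {..<r}. \<forall>k<r. z k \<in> {0, 1}}"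

definition simplex_on :: "'a set \<Rightarrow> ('a \<Rightarrow> real) set" where
  "simplex_on J = {x \<in> nonneg_vectors J. sum x J = 1}"

definition ground :: "'i set \<Rightarrow> ('i \<Rightarrow> 'a set) \<Rightarrow> 'a set" where
  "ground I S = (\<Union>i\<in>I. S i)"

definition CDC :: "'i set \<Rightarrow> ('i \<Rightarrow> 'a set) \<Rightarrow> ('a \<Rightarrow> real) set" where
  "CDC I S = (\<Union>i\<in>I. {x \<in> simplex_on (ground I S). \<forall>v \<in> ground I S - S i. x v = 0})"

text \<open>The middle set of an edge of the intersection graph; the weight is its size.\<close>

definition mid :: "('i \<Rightarrow> 'a set) \<Rightarrow> 'i set \<Rightarrow> 'a set" where
  "mid S e = (\<Inter>i\<in>e. S i)"

definition conflict_edges :: "'i set \<Rightarrow> ('i \<Rightarrow> 'a set) \<Rightarrow> 'a set set" where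
  "conflict_edges I S = {{u, v} | u v. u \<in> ground I S \<and> v \<in> ground I S \<and> u \<noteq> v \<and>
     (\<forall>i\<in>I. \<not> {u, v} \<subseteq> S i)}"

text \<open>The conflict graph depends on the family only through its constraint \<open>CDC\<close>: conflicting
  indices are those that are never simultaneously positive.\<close>

lemma conflict_edges_CDC:
  assumes fin: "finite (ground I S)" and uv: "u \<in> ground I S" "v \<in> ground I S" "u \<noteq> v"
  shows "{u, v} \<in> conflict_edges I S \<longleftrightarrow> (\<forall>x\<in>CDC I S. \<not> (0 < x u \<and> 0 < x v))"
proof
  assume "{u, v} \<in> conflict_edges I S"
  then have no: "\<not> {u, v} \<subseteq> S i" if "i \<in> I" for i
    using that unfolding conflict_edges_def by (auto simp: doubleton_eq_iff)
  show "\<forall>x\<in>CDC I S. \<not> (0 < x u \<and> 0 < x v)"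
  proof (intro ballI notI)
    fix x assume "x \<in> CDC I S" and pos: "0 < x u \<and> 0 < x v"
    then obtain i where i: "i \<in> I" "\<forall>w \<in> ground I S - S i. x w = 0"
      unfolding CDC_def by auto
    then have "u \<in> S i" "v \<in> S i" using pos uv by force+
    then show False using no[OF i(1)] by simp
  qed
next
  assume R: "\<forall>x\<in>CDC I S. \<not> (0 < x u \<and> 0 < x v)"
  have "\<not> {u, v} \<subseteq> S i" if i: "i \<in> I" for i
  proof
    assume sub: "{u, v} \<subseteq> S i"
    define x :: "_ \<Rightarrow> real" where "x = (\<lambda>w. if w \<in> {u, v} then 1/2 else 0)"
    have "sum x (ground I S) = sum x {u, v}"
      by (rule sum.mono_neutral_right) (use fin uv in \<open>auto simp: x_def\<close>)
    also have "\<dots> = 1" using uv by (simp add: x_def)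
    finally have "x \<in> simplex_on (ground I S)"
      using uv by (auto simp: simplex_on_def nonneg_vectors_def vectors_def x_def)
    then have "x \<in> CDC I S"
      using i sub unfolding CDC_def by (auto simp: x_def intro!: bexI[of _ i])
    then show False using R by (auto simp: x_def)
  qed
  then show "{u, v} \<in> conflict_edges I S"
    using uv unfolding conflict_edges_def by blast
qed


section \<open>The biclique cover procedure\<close>

text \<open>A biclique \<open>{A, B}\<close> is kept as an ordered pair \<open>(A, B)\<close>; which side comes first
  is left open by the separation relation.\<close>

definition biclique_subgraph :: "'a set \<Rightarrow> 'a set set \<Rightarrow> 'a set \<times> 'a set \<Rightarrow> bool" where
  "biclique_subgraph V E = (\<lambda>(A, B). A \<subseteq> V \<and> B \<subseteq> V \<and> A \<inter> B = {} \<and>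
     (\<forall>a\<in>A. \<forall>b\<in>B. {a, b} \<in> E))"

text \<open>The vertices of the subtree containing \<open>a\<close> after removal of the edge \<open>{a, b}\<close>,
  and the difference in size of the two subtrees.\<close>

definition side :: "'i set set \<Rightarrow> 'i \<Rightarrow> 'i \<Rightarrow> 'i set" where
  "side E a b = reach (E - {{a, b}}) a"

definition imbalance :: "'i set set \<Rightarrow> 'i \<Rightarrow> 'i \<Rightarrow> int" where
  "imbalance E a b = \<bar>int (card (side E a b)) - int (card (side E b a))\<bar>"

definition edges_within :: "'i set set \<Rightarrow> 'i set \<Rightarrow> 'i set set" where
  "edges_within E V = {e \<in> E. e \<subseteq> V}"

inductive separation ::
    "('i \<Rightarrow> 'a set) \<Rightarrow> 'i set \<Rightarrow> 'i set set \<Rightarrow> ('a set \<times> 'a set) list \<Rightarrow> bool"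
  for S :: "'i \<Rightarrow> 'a set" where
  stop: "card V \<le> 1 \<Longrightarrow> separation S V E []"
| split: "\<lbrakk>1 < card V; {a, b} \<in> E;
     \<forall>c d. {c, d} \<in> E \<longrightarrow> imbalance E a b \<le> imbalance E c d;
     V1 = side E a b; V2 = side E b a;
     separation S V1 (edges_within E V1) L1; separation S V2 (edges_within E V2) L2\<rbrakk>
   \<Longrightarrow> separation S V E
     (((\<Union>i\<in>V1. S i) - mid S {a, b}, (\<Union>i\<in>V2. S i) - mid S {a, b})
       # take 1 L1 @ take 1 L2 @ drop 1 L1 @ drop 1 L2)"

fun merge_one :: "('a set \<times> 'a set \<Rightarrow> bool) \<Rightarrow> 'a set \<times> 'a set \<Rightarrow>
    ('a set \<times> 'a set) list \<Rightarrow> ('a set \<times> 'a set) list" where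
  "merge_one ok (A, B) [] = [(A, B)]"
| "merge_one ok (A, B) ((A', B') # M) =
     (if ok (A' \<union> A, B' \<union> B) then (A' \<union> A, B' \<union> B) # M
      else if ok (A' \<union> B, B' \<union> A) then (A' \<union> B, B' \<union> A) # M
      else (A', B') # merge_one ok (A, B) M)"

definition merging :: "('a set \<times> 'a set \<Rightarrow> bool) \<Rightarrow>
    ('a set \<times> 'a set) list \<Rightarrow> ('a set \<times> 'a set) list" where
  "merging ok L = fold (merge_one ok) L []"

text \<open>\<open>C\<close> is a possible output of the procedure on the tree with vertices \<open>S i\<close>, \<open>i \<in> I\<close>,
  and edge set \<open>T\<close>.\<close>

definition procedure_output ::
    "'i set \<Rightarrow> ('i \<Rightarrow> 'a set) \<Rightarrow> 'i set set \<Rightarrow> ('a set \<times> 'a set) list \<Rightarrow> bool" where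
  "procedure_output I S T C \<longleftrightarrow> (\<exists>L. separation S I T L \<and>
     C = merging (biclique_subgraph (ground I S) (conflict_edges I S)) L)"


section \<open>The formulations\<close>

text \<open>The field \<open>cont_index\<close> indexes the continuous variables other than \<open>\<lambda>\<close>, which
  is regarded as projected out. The feasible points are triples of \<open>\<lambda>\<close>, the
  remaining continuous variables, and the binary variables.\<close>

record ('v, 'c) formulation =
  cont_index :: "'c set"
  num_binary :: nat
  feasible :: "(('v \<Rightarrow> real) \<times> ('c \<Rightarrow> real) \<times> (nat \<Rightarrow> real)) set"

definition num_cont :: "('v, 'c) formulation \<Rightarrow> nat" where
  "num_cont F = card (cont_index F)"

definition biclique_formulation ::
    "'v set \<Rightarrow> ('u \<Rightarrow> 'v) \<Rightarrow> 'u set \<Rightarrow> ('u set \<times> 'u set) list \<Rightarrow> ('v, 'u) formulation" where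
  "biclique_formulation J \<alpha> J' C = \<lparr>
     cont_index = J',
     num_binary = length C,
     feasible = {(x, x', z). x \<in> vectors J \<and> x' \<in> simplex_on J' \<and> z \<in> binary_vectors (length C) \<and>
       (\<forall>v\<in>J. x v = (\<Sum>u \<in> {u \<in> J'. \<alpha> u = v}. x' u)) \<and>
       (\<forall>j<length C. (\<Sum>v \<in> fst (C ! j). x' v) \<le> z j \<and> (\<Sum>v \<in> snd (C ! j). x' v) \<le> 1 - z j)}\<rparr>"

definition disjoint_copies ::
    "nat \<Rightarrow> (nat \<Rightarrow> 'v set) \<Rightarrow> ('u \<Rightarrow> 'v) \<Rightarrow> (nat \<Rightarrow> 'u set) \<Rightarrow> bool" where
  "disjoint_copies d S \<alpha> S' \<longleftrightarrow> disjoint_family_on S' {1..d} \<and>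
     (\<forall>i\<in>{1..d}. bij_betw \<alpha> (S' i) (S i))"

text \<open>States of the identification loop are pairs of the set of selected indices and the
  current family.\<close>

inductive identify_step :: "('u \<Rightarrow> 'v) \<Rightarrow> nat set set \<Rightarrow>
    nat set \<times> (nat \<Rightarrow> 'u set) \<Rightarrow> nat set \<times> (nat \<Rightarrow> 'u set) \<Rightarrow> bool"
  for \<alpha> T where
  "\<lbrakk>{i, j} \<in> T; i \<in> X; j \<notin> X\<rbrakk> \<Longrightarrow> identify_step \<alpha> T (X, S)
     (insert j X, S(j := {y \<in> S j. \<forall>x\<in>S i. \<alpha> x \<noteq> \<alpha> y} \<union> {x \<in> S i. \<exists>y\<in>S j. \<alpha> x = \<alpha> y}))"

definition is_F1 :: "nat \<Rightarrow> (nat \<Rightarrow> 'v set) \<Rightarrow> ('v, 'u) formulation \<Rightarrow> bool" where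
  "is_F1 d S F \<longleftrightarrow> (\<exists>\<alpha> S0 T S' C.
     disjoint_copies d S \<alpha> S0 \<and>
     max_spanning_tree {1..d} (complete_edges {1..d}) (\<lambda>e. card (mid S e)) T \<and>
     (identify_step \<alpha> T)\<^sup>*\<^sup>* ({1}, S0) ({1..d}, S') \<and>
     procedure_output {1..d} S' T C \<and>
     F = biclique_formulation (ground {1..d} S) \<alpha> (ground {1..d} S') C)"

definition is_F2 :: "nat \<Rightarrow> (nat \<Rightarrow> 'v set) \<Rightarrow> ('v, nat \<times> 'v) formulation \<Rightarrow> bool" where
  "is_F2 d S F \<longleftrightarrow> (\<exists>r h.
     (\<forall>i\<in>{1..d}. h i \<in> binary_vectors r) \<and> inj_on h {1..d} \<and>
     F = \<lparr>
       cont_index = Sigma {1..d} S,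
       num_binary = r,
       feasible = {(x, \<gamma>, z). x \<in> vectors (ground {1..d} S) \<and>
         \<gamma> \<in> nonneg_vectors (Sigma {1..d} S) \<and> z \<in> binary_vectors r \<and>
         (\<forall>v \<in> ground {1..d} S. x v = (\<Sum>i \<in> {i \<in> {1..d}. v \<in> S i}. \<gamma> (i, v))) \<and>
         (\<Sum>i\<in>{1..d}. \<Sum>v\<in>S i. \<gamma> (i, v)) = 1 \<and>
         (\<forall>k<r. (\<Sum>i\<in>{1..d}. \<Sum>v\<in>S i. h i k * \<gamma> (i, v)) = z k)}\<rparr>)"

definition path_edges :: "nat \<Rightarrow> nat set set" where
  "path_edges d = {{i, Suc i} | i. 1 \<le> i \<and> i < d}"

definition is_F3 :: "nat \<Rightarrow> (nat \<Rightarrow> 'v set) \<Rightarrow> ('v, 'u) formulation \<Rightarrow> bool" where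
  "is_F3 d S F \<longleftrightarrow> (\<exists>\<alpha> S' C.
     disjoint_copies d S \<alpha> S' \<and>
     procedure_output {1..d} S' (path_edges d) C \<and>
     F = biclique_formulation (ground {1..d} S) \<alpha> (ground {1..d} S') C)"

end

theory Submission
  imports Defs
begin

text \<open>(F2) and (F3) both have \<open>\<Sum>\<^sub>i |S\<^sup>i|\<close> continuous variables, and each edge \<open>e\<close> of the maximum
  spanning tree \<open>T\<close> identifies \<open>|mid e|\<close> pairs of copies, so (F1) saves exactly the weight of \<open>T\<close>.
  Two polytopes adjacent in the dual graph meet in a segment on a separating line; each of its two
  ends is a vertex of one of them, so dual edges have weight at least 2, and a spanning tree of the
  dual graph has weight at least \<open>2 (d - 1)\<close>. If all polytopes are full-dimensional, no edge at all
  weighs more than 2: a vertex of a third polytope strictly inside a common segment of two polytopes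
  would have interior points of that polytope nearby inside one of the two.\<close>


section \<open>Growing trees one leaf at a time\<close>

text \<open>This form of tree mirrors the identification loop, which also attaches an unselected
  vertex to a selected one; counting along the loop becomes an induction over leaves.\<close>

inductive grown :: "'a set \<Rightarrow> 'a set set \<Rightarrow> bool" where
  single: "grown {v} {}"
| leaf: "\<lbrakk>grown X U; i \<in> X; j \<notin> X\<rbrakk> \<Longrightarrow> grown (insert j X) (insert {i, j} U)"

lemma reach_trans: "b \<in> reach E a \<Longrightarrow> c \<in> reach E b \<Longrightarrow> c \<in> reach E a"
  unfolding reach_def by auto

lemma reach_mono: "E \<subseteq> E' \<Longrightarrow> reach E a \<subseteq> reach E' a"
  unfolding reach_def by (auto elim!: rtranclp_mono[THEN predicate2D, rotated])

lemma reach_edge: "{a, b} \<in> E \<Longrightarrow> b \<in> reach E a"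
  unfolding reach_def by auto

lemma grown_graph:
  assumes "grown X U"
  shows "finite X" "X \<noteq> {}" "finite U" "\<forall>e\<in>U. e \<subseteq> X \<and> card e = 2" "card U + 1 = card X"
    "graph_connected X U"
  using assms
proof (induction rule: grown.induct)
  case (leaf X U i j)
  have new: "{i, j} \<notin> U" using leaf by auto
  {
    case 1 show ?case using leaf by simp
  next
    case 2 show ?case by simp
  next
    case 3 show ?case using leaf by simp
  next
    case 4 show ?case using leaf by (auto simp: card_2_iff)
  next
    case 5 show ?case using leaf new by simp
  next
    case 6
    let ?U = "insert {i, j} U"
    have old: "b \<in> reach ?U a" if "a \<in> X" "b \<in> X" for a b
      using leaf.IH(6) that reach_mono[of U ?U a] unfolding graph_connected_def by blast
    \<comment> \<open>The attaching vertex \<open>i\<close> serves as a hub: every vertex reaches it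
      and is reached from it, so any two vertices are joined through \<open>i\<close>.\<close>
    have "j \<in> reach ?U i" "i \<in> reach ?U j"
      by (auto intro!: reach_edge simp: insert_commute)
    then have hub: "i \<in> reach ?U a" "a \<in> reach ?U i" if "a \<in> insert j X" for a
      using old leaf.hyps that by auto
    have "b \<in> reach ?U a" if "a \<in> insert j X" "b \<in> insert j X" for a b
      by (rule reach_trans[OF hub(1)[OF that(1)] hub(2)[OF that(2)]])
    then show ?case unfolding graph_connected_def by blast
  }
qed (auto simp: graph_connected_def reach_def)

text \<open>A cycle through the new leaf \<open>j\<close> would give it two different neighbours,
  but its only edge is \<open>{i, j}\<close>; a cycle avoiding \<open>j\<close> already lies in
  \<open>U\<close>.\<close>

lemma grown_acyclic: "grown X U \<Longrightarrow> \<not> graph_cycle U xs"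
proof (induction rule: grown.induct)
  case (single v)
  then show ?case by (force simp: graph_cycle_def)
next
  case (leaf X U i j)
  show ?case
  proof
    assume cyc: "graph_cycle (insert {i, j} U) xs"
    let ?n = "length xs"
    have n: "3 \<le> ?n" and dist: "distinct xs"
      and e: "\<And>k. k < ?n \<Longrightarrow> {xs ! k, xs ! (Suc k mod ?n)} \<in> insert {i, j} U"
      using cyc unfolding graph_cycle_def by auto
    have U: "\<And>e. e \<in> U \<Longrightarrow> j \<notin> e" using grown_graph(4)[OF leaf.hyps(1)] leaf.hyps by auto
    show False
    proof (cases "j \<in> set xs")
      case False
      have "{xs ! k, xs ! (Suc k mod ?n)} \<in> U" if k: "k < ?n" for k
      proof -
        have m: "Suc k mod ?n < ?n" by (rule mod_less_divisor) (use n in linarith)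
        have "xs ! k \<in> set xs" "xs ! (Suc k mod ?n) \<in> set xs" using k m by (auto intro!: nth_mem)
        then have "xs ! k \<noteq> j" "xs ! (Suc k mod ?n) \<noteq> j" using False by auto
        then show ?thesis using e[OF k] by (auto simp: doubleton_eq_iff)
      qed
      then have "graph_cycle U xs" unfolding graph_cycle_def using n dist by auto
      then show False using leaf.IH by simp
    next
      case True
      then obtain k where k: "k < ?n" "xs ! k = j" by (auto simp: in_set_conv_nth)
      \<comment> \<open>\<open>p\<close> and \<open>s\<close> are the cyclic predecessor and
        successor positions of \<open>j\<close>; they differ because the cycle has at least three
        vertices.\<close>
      define p where "p = (if k = 0 then ?n - 1 else k - 1)"
      define s where "s = Suc k mod ?n"
      have p: "p < ?n" "Suc p mod ?n = k" using k n unfolding p_def by auto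
      have s: "s < ?n" unfolding s_def by (rule mod_less_divisor) (use n in linarith)
      have ps: "p \<noteq> s"
      proof (cases "Suc k = ?n")
        case True then show ?thesis using n k unfolding p_def s_def by auto
      next
        case False then have "s = Suc k" using k unfolding s_def by auto
        then show ?thesis using n k unfolding p_def by auto
      qed
      have "{j, xs ! s} \<in> insert {i, j} U" using e[OF k(1)] k unfolding s_def by simp
      moreover have "{xs ! p, j} \<in> insert {i, j} U" using e[OF p(1)] p(2) k by simp
      ultimately have "{j, xs ! s} = {i, j}" "{xs ! p, j} = {i, j}"
        using U by blast+
      then have "xs ! s = i" "xs ! p = i" by (auto simp: doubleton_eq_iff)
      then show False using ps dist s p(1) by (metis nth_eq_iff_index_eq)
    qed
  qed
qed

lemma grown_tree: "grown X U \<Longrightarrow> graph_tree X U"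
  unfolding graph_tree_def simple_graph_def using grown_graph[of X U] grown_acyclic[of X U] by blast

lemma reach_leaves_set:
  assumes "w \<in> reach E v" "v \<in> X" "w \<notin> X"
  shows "\<exists>x y. {x, y} \<in> E \<and> x \<in> X \<and> y \<notin> X"
proof -
  have "(\<lambda>x y. {x, y} \<in> E)\<^sup>*\<^sup>* v w" using assms(1) unfolding reach_def by simp
  then show ?thesis using assms(2,3)
    by (induction rule: rtranclp_induct) blast+
qed

text \<open>Greedy growth: while \<open>X\<close> is a proper subset of \<open>V\<close>,
  connectivity provides an edge leaving \<open>X\<close>, which is added as a new leaf.\<close>

lemma ex_grown:
  assumes fin: "finite V" and v: "v \<in> V" and E: "\<forall>e\<in>E. e \<subseteq> V" and conn: "graph_connected V E"
  shows "\<exists>U \<subseteq> E. grown V U"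
proof -
  have "\<exists>X U. X \<subseteq> V \<and> U \<subseteq> E \<and> grown X U \<and> card X = Suc k" if "Suc k \<le> card V" for k
    using that
  proof (induction k)
    case 0
    show ?case using v grown.single[of v] by (intro exI[of _ "{v}"] exI[of _ "{}"]) auto
  next
    case (Suc k)
    then obtain X U where XU: "X \<subseteq> V" "U \<subseteq> E" "grown X U" "card X = Suc k" by auto
    obtain a where a: "a \<in> X" using XU by fastforce
    have "X \<noteq> V" using XU Suc.prems by auto
    then obtain b where b: "b \<in> V" "b \<notin> X" using XU by auto
    have "b \<in> reach E a" using conn a b XU unfolding graph_connected_def by blast
    from reach_leaves_set[OF this a b(2)] obtain x y where xy: "{x, y} \<in> E" "x \<in> X" "y \<notin> X" by blast
    have "finite X" using XU fin finite_subset by blast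
    then show ?case using XU xy E
      by (intro exI[of _ "insert y X"] exI[of _ "insert {x, y} U"]) (auto intro: grown.leaf)
  qed
  from this[of "card V - 1"] obtain X U where XU: "X \<subseteq> V" "U \<subseteq> E" "grown X U" "card X = card V"
    using v fin by (metis One_nat_def Suc_pred card_gt_0_iff empty_iff order_refl)
  then have "X = V" using fin card_subset_eq by blast
  then show ?thesis using XU by auto
qed

section \<open>Simple paths and the edges of a tree\<close>

lemma reach_simple_path:
  assumes "b \<in> reach E a"
  shows "\<exists>xs. xs \<noteq> [] \<and> hd xs = a \<and> last xs = b \<and> distinct xs \<and>
    (\<forall>k. Suc k < length xs \<longrightarrow> {xs ! k, xs ! Suc k} \<in> E)"
proof -
  have "(\<lambda>x y. {x, y} \<in> E)\<^sup>*\<^sup>* a b" using assms unfolding reach_def by simp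
  then show ?thesis
  proof (induction rule: rtranclp_induct)
    case base
    show ?case by (intro exI[of _ "[a]"]) auto
  next
    case (step y z)
    then obtain xs where xs: "xs \<noteq> []" "hd xs = a" "last xs = y" "distinct xs"
      "\<forall>k. Suc k < length xs \<longrightarrow> {xs ! k, xs ! Suc k} \<in> E" by blast
    show ?case
    proof (cases "z \<in> set xs")
      \<comment> \<open>If \<open>z\<close> is already on the path, the path is cut at
        \<open>z\<close> instead of being extended, which keeps its vertices distinct.\<close>
      case True
      then obtain m where m: "m < length xs" "xs ! m = z" by (auto simp: in_set_conv_nth)
      have "last (take (Suc m) xs) = z" using m by (simp add: take_Suc_conv_app_nth)
      then show ?thesis using xs m by (intro exI[of _ "take (Suc m) xs"]) auto
    next
      case False
      have "{(xs @ [z]) ! k, (xs @ [z]) ! Suc k} \<in> E" if k: "Suc k < length (xs @ [z])" for k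
      proof (cases "Suc k = length xs")
        case True
        then have "xs ! k = y" using xs by (metis diff_Suc_1 last_conv_nth)
        then show ?thesis using step True by (simp add: nth_append)
      next
        case False
        then show ?thesis using k xs by (simp add: nth_append)
      qed
      then show ?thesis using False xs by (intro exI[of _ "xs @ [z]"]) auto
    qed
  qed
qed

text \<open>An extra edge would close a cycle with the path in \<open>U\<close> between its ends.\<close>

lemma tree_edges_minimal:
  assumes T: "graph_tree V T" and U: "U \<subseteq> T" "graph_connected V U"
  shows "T = U"
proof (rule ccontr)
  assume "T \<noteq> U"
  then obtain e where e: "e \<in> T" "e \<notin> U" using U by auto
  then have "e \<subseteq> V" "card e = 2" using T unfolding graph_tree_def simple_graph_def by auto
  then obtain u v where uv: "e = {u, v}" "u \<noteq> v" "u \<in> V" "v \<in> V" by (auto simp: card_2_iff)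
  have "v \<in> reach U u" using U(2) uv unfolding graph_connected_def by blast
  then obtain xs where xs: "xs \<noteq> []" "hd xs = u" "last xs = v" "distinct xs"
    "\<forall>k. Suc k < length xs \<longrightarrow> {xs ! k, xs ! Suc k} \<in> U"
    using reach_simple_path by meson
  have first: "xs ! 0 = u" and final: "xs ! (length xs - 1) = v"
    using xs by (auto simp: hd_conv_nth last_conv_nth)
  \<comment> \<open>Length 1 would mean \<open>u = v\<close>, and length 2 would put
    \<open>e\<close> itself into \<open>U\<close>.\<close>
  have "length xs \<noteq> 1" using first final uv by auto
  moreover have "length xs \<noteq> 2"
  proof
    assume "length xs = 2"
    then have "{xs ! 0, xs ! 1} \<in> U" "xs ! 1 = v" using xs(5) final by auto
    then show False using first e uv by simp
  qed
  moreover have "length xs \<noteq> 0" using xs by simp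
  ultimately have "3 \<le> length xs" by linarith
  \<comment> \<open>Only the pair that wraps around leaves the path in \<open>U\<close>, and that
    pair is the edge \<open>e\<close>.\<close>
  moreover have "{xs ! k, xs ! (Suc k mod length xs)} \<in> T" if "k < length xs" for k
  proof (cases "Suc k = length xs")
    case True
    then have "xs ! k = v" using final by (metis diff_Suc_1)
    then show ?thesis using True first e uv by (simp add: insert_commute)
  next
    case False
    then show ?thesis using xs(5) that U by auto
  qed
  ultimately have "graph_cycle T xs" unfolding graph_cycle_def using xs by simp
  then show False using T unfolding graph_tree_def by blast
qed

lemma card_tree_edges:
  assumes "graph_tree V T"
  shows "card T + 1 = card V"
proof -
  have V: "finite V" "V \<noteq> {}" "\<forall>e\<in>T. e \<subseteq> V" "graph_connected V T"
    using assms unfolding graph_tree_def simple_graph_def by auto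
  then obtain U where "U \<subseteq> T" "grown V U" using ex_grown[of V _ T] by blast
  then show ?thesis using tree_edges_minimal[OF assms] grown_graph by metis
qed

text \<open>A spanning tree chosen inside \<open>E'\<close> has \<open>card V - 1\<close> edges of
  weight at least \<open>c\<close> and competes with \<open>T\<close>. Here \<open>E'\<close> will
  be the dual graph.\<close>

lemma max_spanning_tree_weight_ge:
  assumes T: "max_spanning_tree V E w T" and E': "E' \<subseteq> E" "\<forall>e\<in>E'. e \<subseteq> V"
    and conn: "graph_connected V E'" and w: "\<forall>e\<in>E'. c \<le> w e"
  shows "c * (card V - 1) \<le> sum w T"
proof -
  have "finite V" "V \<noteq> {}"
    using T unfolding max_spanning_tree_def spanning_tree_def graph_tree_def simple_graph_def by auto
  then obtain U where U: "U \<subseteq> E'" "grown V U" using ex_grown[of V _ E'] conn E' by blast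
  have "c * (card V - 1) = (\<Sum>e\<in>U. c)" by (simp flip: grown_graph(5)[OF U(2)])
  also have "\<dots> \<le> sum w U" by (rule sum_mono) (use U w in auto)
  also have "\<dots> \<le> sum w T"
    using T U E' grown_tree[OF U(2)] unfolding max_spanning_tree_def spanning_tree_def by blast
  finally show ?thesis .
qed


section \<open>Counting the continuous variables\<close>

lemma card_ground_disjoint_copies:
  assumes "disjoint_copies d S \<alpha> S'" and "\<forall>i\<in>{1..d}. finite (S i)"
  shows "card (ground {1..d} S') = (\<Sum>i\<in>{1..d}. card (S i))"
proof -
  have bij: "\<forall>i\<in>{1..d}. bij_betw \<alpha> (S' i) (S i)" and disj: "disjoint_family_on S' {1..d}"
    using assms unfolding disjoint_copies_def by auto
  then have "\<forall>i\<in>{1..d}. finite (S' i)" using assms(2) bij_betw_finite by blast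
  then have "card (ground {1..d} S') = (\<Sum>i\<in>{1..d}. card (S' i))"
    unfolding ground_def using disj
    by (intro card_UN_disjoint) (auto simp: disjoint_family_on_def)
  also have "\<dots> = (\<Sum>i\<in>{1..d}. card (S i))"
    by (rule sum.cong[OF refl]) (rule bij_betw_same_card[OF bij[rule_format]])
  finally show ?thesis .
qed

text \<open>One pass of the loop: \<open>Z\<close> holds the indices in use, \<open>X\<close> is the
  copy of \<open>A\<close> at the selected vertex, \<open>Y\<close> the fresh copy of
  \<open>B\<close>. Only \<open>B - A\<close> brings new indices. The count is written additively to
  avoid subtraction of naturals.\<close>

lemma glue_copies:
  fixes \<alpha> :: "'u \<Rightarrow> 'v"
  assumes X: "bij_betw \<alpha> X A" and Y: "bij_betw \<alpha> Y B" and fin: "finite A" "finite B"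
    and Z: "X \<subseteq> Z" "Z \<inter> Y = {}" "finite Z"
  defines "Y' \<equiv> {y \<in> Y. \<forall>x\<in>X. \<alpha> x \<noteq> \<alpha> y} \<union> {x \<in> X. \<exists>y\<in>Y. \<alpha> x = \<alpha> y}"
  shows "bij_betw \<alpha> Y' B" "card (Z \<union> Y') + card (A \<inter> B) = card Z + card B"
proof -
  have img: "\<alpha> ` X = A" "\<alpha> ` Y = B" "inj_on \<alpha> X" "inj_on \<alpha> Y" using X Y by (simp_all add: bij_betw_def)
  show "bij_betw \<alpha> Y' B" unfolding bij_betw_def
  proof
    show "inj_on \<alpha> Y'"
    proof (rule inj_onI)
      fix p q assume "p \<in> Y'" "q \<in> Y'" and eq: "\<alpha> p = \<alpha> q"
      \<comment> \<open>A kept element of \<open>Y\<close> shares its image with no element of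
        \<open>X\<close>, so the mixed case cannot occur.\<close>
      then consider "p \<in> Y" "q \<in> Y" | "p \<in> X" "q \<in> X"
        unfolding Y'_def by (metis (mono_tags, lifting) UnE mem_Collect_eq)
      then show "p = q" by cases (use img(3,4) eq in \<open>auto dest: inj_onD\<close>)
    qed
    show "\<alpha> ` Y' = B"
    proof
      have "\<alpha> y \<in> B" if "y \<in> Y" for y using img(2) that by blast
      then show "\<alpha> ` Y' \<subseteq> B" unfolding Y'_def by fastforce
      show "B \<subseteq> \<alpha> ` Y'"
      proof
        fix b assume "b \<in> B"
        then obtain y where y: "y \<in> Y" "b = \<alpha> y" using img by blast
        show "b \<in> \<alpha> ` Y'"
        proof (cases "\<exists>x\<in>X. \<alpha> x = \<alpha> y")
          case True
          then obtain x where "x \<in> X" "\<alpha> x = \<alpha> y" by blast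
          then have "x \<in> Y'" "b = \<alpha> x" using y unfolding Y'_def by auto
          then show ?thesis by (rule rev_image_eqI)
        next
          case False
          then have "y \<in> Y'" using y unfolding Y'_def by blast
          then show ?thesis using y by blast
        qed
      qed
    qed
  qed
  let ?N = "{y \<in> Y. \<forall>x\<in>X. \<alpha> x \<noteq> \<alpha> y}"
  have imgN: "\<alpha> ` ?N = B - A"
  proof
    show "\<alpha> ` ?N \<subseteq> B - A" unfolding img(1,2)[symmetric] by fastforce
    show "B - A \<subseteq> \<alpha> ` ?N"
    proof
      fix b assume b: "b \<in> B - A"
      then obtain y where y: "y \<in> Y" "b = \<alpha> y" using img(2) by blast
      have "\<alpha> x \<in> A" if "x \<in> X" for x using img(1) that by auto
      then have "\<forall>x\<in>X. \<alpha> x \<noteq> \<alpha> y" using b y(2) by (metis DiffD2)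
      then have "y \<in> ?N" using y(1) by simp
      then show "b \<in> \<alpha> ` ?N" unfolding y(2) by (rule imageI)
    qed
  qed
  have "inj_on \<alpha> ?N" using img(4) by (rule inj_on_subset) auto
  then have N: "card ?N = card (B - A)" by (simp add: card_image flip: imgN)
  have "finite Y" using bij_betw_finite[OF Y] fin by simp
  then have finN: "finite ?N" by simp
  \<comment> \<open>The replaced part of \<open>Y'\<close> comes from \<open>X\<close> and is
    therefore already counted in \<open>Z\<close>.\<close>
  have "Z \<union> Y' = Z \<union> ?N" using Z unfolding Y'_def by auto
  moreover have "Z \<inter> ?N = {}" using Z by auto
  ultimately have "card (Z \<union> Y') = card Z + card (B - A)"
    using card_Un_disjoint[OF Z(3) finN] N by simp
  moreover have "card (B - A) + card (A \<inter> B) = card B"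
    using card_Int_Diff[OF fin(2), of A] by (simp add: Int_commute)
  ultimately show "card (Z \<union> Y') + card (A \<inter> B) = card Z + card B" by simp
qed

text \<open>Loop invariant, with \<open>U\<close> the tree edges used so far. The clauses on
  unselected copies and on the ground set ensure that the next copy is still disjoint from all
  indices in use.\<close>

lemma identify_steps:
  assumes steps: "(identify_step \<alpha> T)\<^sup>*\<^sup>* ({1}, S0) (X, S')"
    and copies: "disjoint_copies d S \<alpha> S0" and fin: "\<forall>i\<in>{1..d}. finite (S i)"
    and T: "T \<subseteq> complete_edges {1..d}" and d: "1 \<le> d"
  shows "X \<subseteq> {1..d} \<and> (\<forall>i\<in>{1..d}. bij_betw \<alpha> (S' i) (S i)) \<and>
    (\<forall>j. j \<notin> X \<longrightarrow> S' j = S0 j) \<and> ground X S' \<subseteq> ground X S0 \<and>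
    (\<exists>U\<subseteq>T. grown X U \<and>
      card (ground X S') + (\<Sum>e\<in>U. card (mid S e)) = (\<Sum>i\<in>X. card (S i)))"
  using steps
proof (induction rule: rtranclp_induct2)
  case refl
  have "bij_betw \<alpha> (S0 1) (S 1)" using copies d unfolding disjoint_copies_def by auto
  then have "card (ground {1} S0) = card (S 1)" unfolding ground_def
    by (simp add: bij_betw_same_card)
  then have "\<exists>U\<subseteq>T. grown {1} U \<and>
      card (ground {1} S0) + (\<Sum>e\<in>U. card (mid S e)) = (\<Sum>i\<in>{1}. card (S i))"
    using grown.single[of "1::nat"] by (intro exI[of _ "{}"]) simp
  then show ?case using copies d unfolding disjoint_copies_def by simp
next
  case (step X S' X2 S2)
  then obtain U where IH: "X \<subseteq> {1..d}" "\<forall>i\<in>{1..d}. bij_betw \<alpha> (S' i) (S i)"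
    "\<forall>j. j \<notin> X \<longrightarrow> S' j = S0 j" "ground X S' \<subseteq> ground X S0" "U \<subseteq> T" "grown X U"
    "card (ground X S') + (\<Sum>e\<in>U. card (mid S e)) = (\<Sum>i\<in>X. card (S i))" by blast
  from step.hyps(2) obtain i j where ij: "{i, j} \<in> T" "i \<in> X" "j \<notin> X" and X2: "X2 = insert j X"
    and S2: "S2 = S'(j := {y \<in> S' j. \<forall>x\<in>S' i. \<alpha> x \<noteq> \<alpha> y} \<union> {x \<in> S' i. \<exists>y\<in>S' j. \<alpha> x = \<alpha> y})"
    by (cases rule: identify_step.cases) auto
  have j: "j \<in> {1..d}" and i: "i \<in> {1..d}" using ij T unfolding complete_edges_def by auto
  have finX: "finite X" using IH(1) finite_subset by auto
  have finS': "finite (S' k)" if "k \<in> {1..d}" for k using IH(2) fin that bij_betw_finite by blast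
  have sub: "S' i \<subseteq> ground X S'" unfolding ground_def using ij by auto
  have finG: "finite (ground X S')" unfolding ground_def using finX finS' IH(1) by auto
  have "disjoint_family_on S0 {1..d}" using copies unfolding disjoint_copies_def by simp
  then have "S0 k \<inter> S0 j = {}" if "k \<in> X" for k
    using that IH(1) j ij by (metis disjoint_family_onD subsetD)
  then have "ground X S0 \<inter> S0 j = {}" unfolding ground_def by blast
  then have disj: "ground X S' \<inter> S' j = {}" using IH(3,4) ij by auto
  have bi: "bij_betw \<alpha> (S' i) (S i)" and bj: "bij_betw \<alpha> (S' j) (S j)" using IH(2) i j by auto
  have fi: "finite (S i)" and fj: "finite (S j)" using fin i j by auto
  note glue = glue_copies[OF bi bj fi fj sub disj finG]
  have bij2: "\<forall>k\<in>{1..d}. bij_betw \<alpha> (S2 k) (S k)" using IH(2) glue(1) unfolding S2 by auto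
  have old: "ground X S2 = ground X S'" unfolding ground_def S2 using ij by auto
  have ground2: "ground X2 S2 = ground X S' \<union> S2 j" using old unfolding X2 ground_def by auto
  have "S2 j \<subseteq> S0 j \<union> ground X S'" using IH(3) ij sub unfolding S2 by auto
  then have le: "ground X2 S2 \<subseteq> ground X2 S0" using ground2 IH(4) unfolding X2 ground_def by auto
  have mid: "mid S {i, j} = S i \<inter> S j" unfolding mid_def by auto
  have card2: "card (ground X2 S2) + card (S i \<inter> S j) = card (ground X S') + card (S j)"
    using glue(2) unfolding ground2 by (simp add: S2)
  \<comment> \<open>\<open>j\<close> was outside \<open>X\<close>, so the edge is new and its weight
    enters the sum exactly once.\<close>
  have "{i, j} \<notin> U" using grown_graph(4)[OF IH(6)] ij by auto
  then have "(\<Sum>e\<in>insert {i, j} U. card (mid S e)) = card (S i \<inter> S j) + (\<Sum>e\<in>U. card (mid S e))"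
    using grown_graph(3)[OF IH(6)] mid by simp
  moreover have "(\<Sum>k\<in>X2. card (S k)) = card (S j) + (\<Sum>k\<in>X. card (S k))"
    unfolding X2 using finX ij by simp
  ultimately have "card (ground X2 S2) + (\<Sum>e\<in>insert {i, j} U. card (mid S e)) = (\<Sum>k\<in>X2. card (S k))"
    using card2 IH(7) by simp
  moreover have "grown X2 (insert {i, j} U)" unfolding X2 using IH(6) ij by (auto intro: grown.leaf)
  moreover have "insert {i, j} U \<subseteq> T" using IH(5) ij by auto
  moreover have "\<forall>k. k \<notin> X2 \<longrightarrow> S2 k = S0 k" unfolding X2 S2 using IH(3) by auto
  ultimately show ?case using IH(1) j bij2 le unfolding X2 by blast
qed

text \<open>When all vertices are selected, the edges used form a connected spanning subset of
  \<open>T\<close>, hence all of \<open>T\<close> by minimality. The saving is thus independent of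
  the order of selection.\<close>

lemma num_cont_F1:
  assumes "is_F1 d S F" and fin: "\<forall>i\<in>{1..d}. finite (S i)" and d: "1 \<le> d"
  obtains T where "max_spanning_tree {1..d} (complete_edges {1..d}) (\<lambda>e. card (mid S e)) T"
    "num_cont F + (\<Sum>e\<in>T. card (mid S e)) = (\<Sum>i\<in>{1..d}. card (S i))"
proof -
  obtain \<alpha> S0 T S' C where copies: "disjoint_copies d S \<alpha> S0"
    and T: "max_spanning_tree {1..d} (complete_edges {1..d}) (\<lambda>e. card (mid S e)) T"
    and steps: "(identify_step \<alpha> T)\<^sup>*\<^sup>* ({1}, S0) ({1..d}, S')"
    and F: "F = biclique_formulation (ground {1..d} S) \<alpha> (ground {1..d} S') C"
    using assms(1) unfolding is_F1_def by blast
  have tree: "graph_tree {1..d} T" "T \<subseteq> complete_edges {1..d}"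
    using T unfolding max_spanning_tree_def spanning_tree_def by auto
  obtain U where U: "U \<subseteq> T" "grown {1..d} U"
    "card (ground {1..d} S') + (\<Sum>e\<in>U. card (mid S e)) = (\<Sum>i\<in>{1..d}. card (S i))"
    using identify_steps[OF steps copies fin tree(2) d] by blast
  have "T = U" using tree_edges_minimal[OF tree(1) U(1)] grown_graph(6)[OF U(2)] by simp
  moreover have "num_cont F = card (ground {1..d} S')"
    unfolding F num_cont_def biclique_formulation_def by simp
  ultimately show thesis using that T U(3) by simp
qed

lemma num_cont_F2:
  assumes "is_F2 d S F" and "\<forall>i\<in>{1..d}. finite (S i)"
  shows "num_cont F = (\<Sum>i\<in>{1..d}. card (S i))"
proof -
  have "cont_index F = Sigma {1..d} S" using assms(1) unfolding is_F2_def by auto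
  then show ?thesis unfolding num_cont_def using assms(2) by simp
qed

lemma num_cont_F3:
  assumes "is_F3 d S F" and "\<forall>i\<in>{1..d}. finite (S i)"
  shows "num_cont F = (\<Sum>i\<in>{1..d}. card (S i))"
proof -
  obtain \<alpha> S' C where "disjoint_copies d S \<alpha> S'"
    "F = biclique_formulation (ground {1..d} S) \<alpha> (ground {1..d} S') C"
    using assms(1) unfolding is_F3_def by blast
  then show ?thesis using card_ground_disjoint_copies assms(2)
    unfolding num_cont_def biclique_formulation_def by simp
qed


section \<open>Vertices shared by two polytopes of a partition\<close>

lemma plane_orthogonal_parallel:
  fixes a y z :: "real^2"
  assumes a: "a \<noteq> 0" and y: "a \<bullet> y = 0" and z: "a \<bullet> z = 0" "z \<noteq> 0"
  shows "\<exists>t. y = t *\<^sub>R z"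
proof -
  have eqs: "a$1 * y$1 + a$2 * y$2 = 0" "a$1 * z$1 + a$2 * z$2 = 0"
    using y z by (simp_all add: inner_vec_def sum_2)
  \<comment> \<open>Both coordinates of \<open>a\<close> annihilate the determinant of
    \<open>y\<close> and \<open>z\<close>; since \<open>a\<close> is nonzero, the determinant
    vanishes.\<close>
  have "a$1 * (y$1 * z$2 - y$2 * z$1) = 0" "a$2 * (y$1 * z$2 - y$2 * z$1) = 0"
    using eqs by algebra+
  moreover have "a$1 \<noteq> 0 \<or> a$2 \<noteq> 0" using a by (simp add: vec_eq_iff forall_2)
  ultimately have det: "y$1 * z$2 = y$2 * z$1" by auto
  consider "z$1 \<noteq> 0" | "z$2 \<noteq> 0" using z(2) by (auto simp: vec_eq_iff forall_2)
  then show ?thesis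
  proof cases
    case 1
    then show ?thesis using det
      by (intro exI[of _ "y$1 / z$1"]) (simp add: vec_eq_iff forall_2 field_simps)
  next
    case 2
    then show ?thesis using det
      by (intro exI[of _ "y$2 / z$2"]) (simp add: vec_eq_iff forall_2 field_simps)
  qed
qed

lemma convex_on_line:
  assumes "convex A" "x + q *\<^sub>R e \<in> A" "x + p *\<^sub>R e \<in> A" "q \<le> m" "m \<le> p"
  shows "x + m *\<^sub>R e \<in> A"
proof (cases "q = p")
  case True
  then show ?thesis using assms by simp
next
  case False
  define u where "u = (m - q) / (p - q)"
  have u: "0 \<le> u" "u \<le> 1" using False assms(4,5) unfolding u_def by (auto simp: divide_simps)
  have "u * (p - q) = m - q" using False unfolding u_def by simp
  then have m: "m = (1 - u) * q + u * p" by (simp add: algebra_simps)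
  have "(1 - u) *\<^sub>R (x + q *\<^sub>R e) + u *\<^sub>R (x + p *\<^sub>R e) \<in> A"
    using assms u by (intro convexD) auto
  then show ?thesis unfolding m by (simp add: algebra_simps)
qed

text \<open>A linear functional that is maximal at a point inside a segment is constant on that
  segment. The shorter of the two pieces gives a step \<open>e\<close> usable in both
  directions.\<close>

lemma not_extreme_point_supporting:
  assumes A: "convex A" "x \<in> A" "\<not> x extreme_point_of A" and sup: "\<forall>y\<in>A. a \<bullet> y \<le> a \<bullet> x"
  shows "\<exists>e. e \<noteq> 0 \<and> a \<bullet> e = 0 \<and> x + e \<in> A \<and> x - e \<in> A"
proof -
  obtain u v where uv: "u \<in> A" "v \<in> A" "x \<in> open_segment u v"
    using A unfolding extreme_point_of_def by blast
  then obtain s where s: "u \<noteq> v" "0 < s" "s < 1" "x = (1 - s) *\<^sub>R u + s *\<^sub>R v"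
    unfolding in_segment by blast
  define m where "m = min s (1 - s)"
  have au: "a \<bullet> u \<le> a \<bullet> x" and av: "a \<bullet> v \<le> a \<bullet> x" using sup uv by auto
  have ax: "a \<bullet> x = (1 - s) * (a \<bullet> u) + s * (a \<bullet> v)" using s(4) by (simp add: inner_add_right)
  have "a \<bullet> (v - u) = 0"
  proof -
    have "(1 - s) * (a \<bullet> x - a \<bullet> u) + s * (a \<bullet> x - a \<bullet> v) = 0" using ax by (simp add: algebra_simps)
    moreover have "0 \<le> (1 - s) * (a \<bullet> x - a \<bullet> u)" "0 \<le> s * (a \<bullet> x - a \<bullet> v)" using au av s by auto
    ultimately have "(1 - s) * (a \<bullet> x - a \<bullet> u) = 0" "s * (a \<bullet> x - a \<bullet> v) = 0" by linarith+
    then show ?thesis using s by (simp add: inner_diff_right)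
  qed
  have ends: "x + (- s) *\<^sub>R (v - u) \<in> A" "x + (1 - s) *\<^sub>R (v - u) \<in> A"
    using uv unfolding s(4) by (simp_all add: algebra_simps)
  have "x + m *\<^sub>R (v - u) \<in> A" "x + (- m) *\<^sub>R (v - u) \<in> A"
    by (rule convex_on_line[OF A(1) ends]; use s in \<open>auto simp: m_def\<close>)+
  then show ?thesis using \<open>a \<bullet> (v - u) = 0\<close> s unfolding m_def
    by (intro exI[of _ "m *\<^sub>R (v - u)"]) (auto simp: m_def)
qed

text \<open>The points common to \<open>A\<close> and \<open>B\<close> lie on the separating line, where each of the two sets
  extends a little in both directions around any point that is not a vertex of it.\<close>

lemma extreme_point_of_Int_separated:
  fixes A B :: "(real^2) set"
  assumes conv: "convex A" "convex B" and a: "a \<noteq> 0" "\<forall>y\<in>A. a \<bullet> y \<le> b" "\<forall>y\<in>B. b \<le> a \<bullet> y"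
    and x: "x extreme_point_of (A \<inter> B)"
  shows "x extreme_point_of A \<or> x extreme_point_of B"
proof (rule ccontr)
  assume no: "\<not> (x extreme_point_of A \<or> x extreme_point_of B)"
  have xAB: "x \<in> A" "x \<in> B" using x unfolding extreme_point_of_def by auto
  then have ax: "a \<bullet> x = b" using a by force
  obtain e where e: "e \<noteq> 0" "a \<bullet> e = 0" "x + e \<in> A" "x - e \<in> A"
    using not_extreme_point_supporting[of A x a] conv xAB no a ax by blast
  \<comment> \<open>\<open>B\<close> lies on the other side of the line, so its supporting
    functional is \<open>- a\<close>.\<close>
  obtain f where f: "f \<noteq> 0" "a \<bullet> f = 0" "x + f \<in> B" "x - f \<in> B"
    using not_extreme_point_supporting[of B x "- a"] conv xAB no a ax by auto
  obtain t where t: "f = t *\<^sub>R e" using plane_orthogonal_parallel[OF a(1) f(2) e(2,1)] by blast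
  have t0: "t \<noteq> 0" using t f by auto
  \<comment> \<open>\<open>e\<close> and \<open>f\<close> are parallel; \<open>m\<close> is a step,
    in units of \<open>e\<close>, that stays in both sets.\<close>
  define m where "m = min 1 \<bar>t\<bar>"
  have m: "0 < m" "m \<le> 1" "m \<le> \<bar>t\<bar>" using t0 unfolding m_def by auto
  have endsA: "x + (- 1) *\<^sub>R e \<in> A" "x + 1 *\<^sub>R e \<in> A" using e by simp_all
  have endsB: "x + (- \<bar>t\<bar>) *\<^sub>R e \<in> B" "x + \<bar>t\<bar> *\<^sub>R e \<in> B"
    using f unfolding t by (cases "0 \<le> t"; simp)+
  have "x + k *\<^sub>R e \<in> A \<inter> B" if "- m \<le> k" "k \<le> m" for k
    using convex_on_line[OF conv(1) endsA, of k] convex_on_line[OF conv(2) endsB, of k] that m by auto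
  from this[of "- m"] this[of m] have "x + (- m) *\<^sub>R e \<in> A \<inter> B" "x + m *\<^sub>R e \<in> A \<inter> B"
    using m by simp_all
  moreover have "x \<in> open_segment (x + (- m) *\<^sub>R e) (x + m *\<^sub>R e)"
  proof -
    have "x = midpoint (x + (- m) *\<^sub>R e) (x + m *\<^sub>R e)"
      by (simp add: midpoint_def scaleR_2[symmetric])
    moreover have "x + (- m) *\<^sub>R e \<noteq> x + m *\<^sub>R e" unfolding add_left_cancel scaleR_cancel_right using m e by auto
    ultimately show ?thesis using midpoint_in_open_segment by metis
  qed
  ultimately show False using x unfolding extreme_point_of_def by blast
qed

lemma separating_hyperplane_rel_interior_disjoint:
  fixes A B :: "'a::euclidean_space set"
  assumes conv: "convex A" "convex B" and ne: "A \<noteq> {}" "B \<noteq> {}"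
    and disj: "rel_interior A \<inter> rel_interior B = {}"
  obtains a b where "a \<noteq> 0" "\<forall>x\<in>A. a \<bullet> x \<le> b" "\<forall>x\<in>B. b \<le> a \<bullet> x"
proof -
  have "convex (rel_interior A)" "convex (rel_interior B)" "rel_interior A \<noteq> {}" "rel_interior B \<noteq> {}"
    using conv ne by (auto simp: convex_rel_interior rel_interior_eq_empty)
  from separating_hyperplane_sets[OF this disj]
  obtain a b where a: "a \<noteq> 0" and A: "rel_interior A \<subseteq> {x. a \<bullet> x \<le> b}"
    and B: "rel_interior B \<subseteq> {x. a \<bullet> x \<ge> b}" by blast
  \<comment> \<open>Closed half-spaces pass from the relative interiors to their closures, which
    contain the convex sets themselves.\<close>
  have "closure (rel_interior A) \<subseteq> {x. a \<bullet> x \<le> b}"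
    using A by (rule closure_minimal) (rule closed_halfspace_le)
  moreover have "closure (rel_interior B) \<subseteq> {x. a \<bullet> x \<ge> b}"
    using B by (rule closure_minimal) (rule closed_halfspace_ge)
  ultimately have "A \<subseteq> {x. a \<bullet> x \<le> b}" "B \<subseteq> {x. a \<bullet> x \<ge> b}"
    using convex_closure_rel_interior conv closure_subset by blast+
  then show thesis using that[OF a, of b] by blast
qed

lemma finite_extreme_points_polytope:
  assumes "polytope P"
  shows "finite {x. x extreme_point_of P}"
proof -
  obtain W where "finite W" "P = convex hull W" using assms unfolding polytope_def by blast
  then show ?thesis using extreme_point_of_convex_hull finite_subset
    by (metis (no_types, lifting) mem_Collect_eq subsetI)
qed

text \<open>By Krein-Milman a polytope is the hull of its extreme points, and the hull of at most
  one point is finite.\<close>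

lemma two_le_card_extreme_points:
  fixes P :: "'a::euclidean_space set"
  assumes P: "polytope P" "infinite P"
  shows "2 \<le> card {x. x extreme_point_of P}"
proof (rule ccontr)
  let ?X = "{x. x extreme_point_of P}"
  assume "\<not> 2 \<le> card ?X"
  then have "card ?X \<le> Suc 0" by simp
  then obtain c where "?X \<subseteq> {c}"
    using finite_extreme_points_polytope[OF P(1)] by (metis card_le_Suc0_iff_eq empty_subsetI insertCI subsetI subset_singletonD)
  then have "convex hull ?X \<subseteq> {c}" by (simp add: hull_minimal)
  moreover have "P = convex hull ?X"
    by (rule Krein_Milman_Minkowski) (use P in \<open>auto simp: polytope_imp_compact polytope_imp_convex\<close>)
  ultimately show False using P(2) finite_subset by (metis finite.emptyI finite_insert)
qed

text \<open>\<open>A \<inter> B\<close> is itself an infinite polytope; each of its extreme points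
  is a vertex of \<open>A\<close> or of \<open>B\<close> by separation.\<close>

lemma two_le_card_common_vertices:
  fixes A B :: "(real^2) set"
  assumes poly: "polytope A" "polytope B" and disj: "rel_interior A \<inter> rel_interior B = {}"
    and inf: "infinite (A \<inter> B)"
  shows "2 \<le> card {x \<in> A \<inter> B. x extreme_point_of A \<or> x extreme_point_of B}"
proof -
  have conv: "convex A" "convex B" using poly by (auto simp: polytope_imp_convex)
  have "A \<noteq> {}" "B \<noteq> {}" using inf by auto
  from separating_hyperplane_rel_interior_disjoint[OF conv this disj]
  obtain a b where a: "a \<noteq> 0" "\<forall>x\<in>A. a \<bullet> x \<le> b" "\<forall>x\<in>B. b \<le> a \<bullet> x" .
  let ?W = "{x \<in> A \<inter> B. x extreme_point_of A \<or> x extreme_point_of B}"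
  have sub: "{x. x extreme_point_of (A \<inter> B)} \<subseteq> ?W"
    using extreme_point_of_Int_separated[OF conv a] by (auto simp: extreme_point_of_def)
  have "?W \<subseteq> {x. x extreme_point_of A} \<union> {x. x extreme_point_of B}" by auto
  then have "finite ?W" by (rule finite_subset) (simp add: poly finite_extreme_points_polytope)
  then have "card {x. x extreme_point_of (A \<inter> B)} \<le> card ?W" using sub by (rule card_mono)
  then show ?thesis using two_le_card_extreme_points[of "A \<inter> B"] inf poly
    by (simp add: polytope_Int)
qed

section \<open>The upper bound of two common vertices for full-dimensional polytopes\<close>

lemma open_decrease_inner:
  fixes a :: "'a::euclidean_space"
  assumes U: "open U" "r \<in> U" and a: "a \<noteq> 0"
  obtains r' where "r' \<in> U" "a \<bullet> r' < a \<bullet> r"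
proof -
  obtain \<epsilon> where \<epsilon>: "0 < \<epsilon>" "ball r \<epsilon> \<subseteq> U" using U openE by blast
  define c where "c = \<epsilon> / (2 * norm a)"
  have c: "0 < c" using \<epsilon> a unfolding c_def by simp
  have "norm (c *\<^sub>R a) = \<epsilon> / 2" using a \<epsilon> unfolding c_def by simp
  then have "r - c *\<^sub>R a \<in> U" using \<epsilon> by (auto simp: dist_norm)
  moreover have "a \<bullet> (r - c *\<^sub>R a) < a \<bullet> r" using c a by (simp add: inner_diff_right)
  ultimately show thesis by (rule that)
qed

text \<open>Near \<open>x\<close>, the ray from \<open>x\<close> towards \<open>r\<close> stays inside the triangle \<open>u v p\<close>: with
  \<open>r - x = s (p - x) + t (v - u)\<close> the barycentric coordinates are nonnegative for small \<open>\<epsilon>\<close>.\<close>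

lemma half_disc_meets:
  fixes A K :: "(real^2) set"
  assumes a: "a \<noteq> 0" and A: "convex A" "u \<in> A" "v \<in> A" "p \<in> A" and K: "convex K" "x \<in> K"
    and line: "a \<bullet> u = b" "a \<bullet> v = b" "a \<bullet> p < b" and x: "x \<in> open_segment u v"
    and r: "r \<in> interior K" "a \<bullet> r < b"
  shows "A \<inter> interior K \<noteq> {}"
proof -
  obtain c where c: "u \<noteq> v" "0 < c" "c < 1" "x = (1 - c) *\<^sub>R u + c *\<^sub>R v"
    using x unfolding in_segment by blast
  have ax: "a \<bullet> x = b" unfolding c(4) using line by (simp add: inner_add_right algebra_simps)
  \<comment> \<open>This \<open>s\<close> matches the heights of \<open>r\<close> and
    \<open>p\<close> below the line, so \<open>r - x - s *\<^sub>R (p - x)\<close> is parallel to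
    the line.\<close>
  define s where "s = (b - a \<bullet> r) / (b - a \<bullet> p)"
  have s: "0 < s" using line r unfolding s_def by simp
  have "s * (b - a \<bullet> p) = b - a \<bullet> r" using line unfolding s_def by simp
  then have "a \<bullet> (r - x - s *\<^sub>R (p - x)) = 0" using ax by (simp add: inner_diff_right algebra_simps)
  moreover have "a \<bullet> (v - u) = 0" "v - u \<noteq> 0" using line c by (auto simp: inner_diff_right)
  ultimately obtain t where t: "r - x - s *\<^sub>R (p - x) = t *\<^sub>R (v - u)"
    using plane_orthogonal_parallel[OF a] by blast
  \<comment> \<open>\<open>m\<close> is the smaller of the weights of \<open>u\<close> and
    \<open>v\<close> in \<open>x\<close>; \<epsilon> keeps the total perturbation of these weights
    within \<open>m\<close>.\<close>
  define m where "m = min c (1 - c)"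
  define \<epsilon> where "\<epsilon> = m / (1 + s + \<bar>t\<bar>)"
  have m: "0 < m" "m \<le> c" "m \<le> 1 - c" "m \<le> 1" using c unfolding m_def by auto
  have \<epsilon>: "0 < \<epsilon>" using m s unfolding \<epsilon>_def by (simp add: add_pos_nonneg)
  have "\<epsilon> * (1 + s + \<bar>t\<bar>) = m" using s unfolding \<epsilon>_def by simp
  then have bound: "\<epsilon> + \<epsilon> * s + \<epsilon> * \<bar>t\<bar> = m" by (simp add: algebra_simps)
  have pos: "0 \<le> \<epsilon> * s" "0 \<le> \<epsilon> * \<bar>t\<bar>" "\<bar>\<epsilon> * t\<bar> = \<epsilon> * \<bar>t\<bar>" using \<epsilon> s by (auto simp: abs_mult)
  have cs: "c * (\<epsilon> * s) \<le> \<epsilon> * s" "0 \<le> c * (\<epsilon> * s)" using pos c by (auto simp: mult_left_le_one_le)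
  \<comment> \<open>The barycentric weights of \<open>u\<close> and \<open>v\<close> in the point
    \<open>y\<close> below; that of \<open>p\<close> is \<open>\<epsilon> * s\<close>.\<close>
  define k1 k2 where "k1 = (1 - c) * (1 - \<epsilon> * s) - \<epsilon> * t" and "k2 = c * (1 - \<epsilon> * s) + \<epsilon> * t"
  have k: "0 \<le> k1" "0 \<le> k2" "k1 + k2 + \<epsilon> * s = 1"
  proof -
    have exp: "k1 = 1 - c - \<epsilon> * s + c * (\<epsilon> * s) - \<epsilon> * t" "k2 = c - c * (\<epsilon> * s) + \<epsilon> * t"
      unfolding k1_def k2_def by (simp_all add: algebra_simps)
    then show "k1 + k2 + \<epsilon> * s = 1" by simp
    have "\<epsilon> * t \<le> \<epsilon> * \<bar>t\<bar>" "- (\<epsilon> * \<bar>t\<bar>) \<le> \<epsilon> * t" using pos(3) by linarith+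
    then show "0 \<le> k1" "0 \<le> k2" using exp cs bound m \<epsilon> by linarith+
  qed
  define y where "y = x - \<epsilon> *\<^sub>R (x - r)"
  have "r - x = s *\<^sub>R (p - x) + t *\<^sub>R (v - u)" using t by (simp add: algebra_simps)
  then have "y = x + \<epsilon> *\<^sub>R (s *\<^sub>R (p - x) + t *\<^sub>R (v - u))"
    unfolding y_def by (metis minus_diff_eq scaleR_minus_right diff_conv_add_uminus)
  then have "y = k1 *\<^sub>R u + k2 *\<^sub>R v + (\<epsilon> * s) *\<^sub>R p"
    unfolding k1_def k2_def c(4) by (simp add: algebra_simps)
  then have "y \<in> convex hull {u, v, p}"
    unfolding convex_hull_3 using k pos by blast
  then have "y \<in> A" using hull_minimal[of "{u, v, p}" A convex] A by auto
  moreover have "y \<in> interior K" unfolding y_def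
    using mem_interior_closure_convex_shrink[OF K(1) r(1), of x \<epsilon>] K(2) closure_subset \<epsilon> bound pos m
    by auto
  ultimately show ?thesis by blast
qed

text \<open>\<open>A\<close> lies in the closure of its interior, and an open set meeting a closure
  meets the set itself.\<close>

lemma interior_meets:
  fixes A K :: "'a::euclidean_space set"
  assumes "convex A" "interior A \<noteq> {}" "A \<inter> interior K \<noteq> {}"
  shows "interior A \<inter> interior K \<noteq> {}"
proof -
  have "interior K \<inter> closure (interior A) \<noteq> {}"
    using assms convex_closure_interior closure_subset by blast
  then show ?thesis using open_Int_closure_eq_empty[of "interior K" "interior A"] by auto
qed

text \<open>\<open>K\<close> has interior points off the line. On whichever side one lies,
  \<open>half_disc_meets\<close> makes the interior of \<open>K\<close> meet \<open>A\<close> or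
  \<open>B\<close>, contradicting disjoint interiors.\<close>

lemma no_point_inside_common_segment:
  fixes A B K :: "(real^2) set"
  assumes conv: "convex A" "convex B" "convex K"
    and int: "interior A \<noteq> {}" "interior B \<noteq> {}" "interior K \<noteq> {}"
    and disj: "interior A \<inter> interior K = {}" "interior B \<inter> interior K = {}"
    and a: "a \<noteq> 0" "\<forall>x\<in>A. a \<bullet> x \<le> b" "\<forall>x\<in>B. b \<le> a \<bullet> x"
    and uv: "u \<in> A \<inter> B" "v \<in> A \<inter> B" and x: "x \<in> open_segment u v" "x \<in> K"
  shows False
proof -
  have line: "a \<bullet> u = b" "a \<bullet> v = b" using uv a by force+
  have below: False if r: "r \<in> interior K" "a \<bullet> r < b" for r
  proof -
    obtain p0 where p0: "p0 \<in> interior A" using int by auto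
    \<comment> \<open>\<open>p0\<close> is only known to satisfy
      \<open>a \<bullet> p0 \<le> b\<close>; moving slightly within the interior makes the
      inequality strict.\<close>
    obtain p where p: "p \<in> interior A" "a \<bullet> p < a \<bullet> p0" using open_decrease_inner[OF open_interior p0 a(1)] .
    have "p0 \<in> A" "p \<in> A" using p0 p interior_subset by auto
    then have "a \<bullet> p < b" using p a by force
    then have "A \<inter> interior K \<noteq> {}"
      using half_disc_meets[of a A u v p K x b r] a conv uv \<open>p \<in> A\<close> line x r by blast
    then show False using interior_meets[of A K] conv int disj by blast
  qed
  have above: False if r: "r \<in> interior K" "b < a \<bullet> r" for r
  proof -
    obtain p0 where p0: "p0 \<in> interior B" using int by auto
    have "- a \<noteq> 0" using a by simp
    then obtain p where p: "p \<in> interior B" "(- a) \<bullet> p < (- a) \<bullet> p0"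
      using open_decrease_inner[OF open_interior p0] by metis
    have "p0 \<in> B" "p \<in> B" using p0 p interior_subset by auto
    then have "(- a) \<bullet> p < - b" using p a by force
    then have "B \<inter> interior K \<noteq> {}"
      using half_disc_meets[of "- a" B u v p K x "- b" r] a conv uv \<open>p \<in> B\<close> line x r by simp
    then show False using interior_meets[of B K] conv int disj by blast
  qed
  obtain r0 where "r0 \<in> interior K" using int by auto
  \<comment> \<open>\<open>r0\<close> might lie on the line; if it is not above, then
    \<open>r\<close> is strictly below.\<close>
  then obtain r where "r \<in> interior K" "a \<bullet> r < a \<bullet> r0"
    using open_decrease_inner[OF open_interior _ a(1)] by metis
  then show False using below[of r] above[of r0] \<open>r0 \<in> interior K\<close> by linarith
qed

text \<open>Of three distinct points on a line, one lies strictly between the other two.\<close>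

lemma card_le_2_between:
  fixes W :: "(real^2) set"
  assumes fin: "finite W" and a: "a \<noteq> 0" "\<forall>x\<in>W. a \<bullet> x = b"
    and no: "\<And>x u v. \<lbrakk>x \<in> W; u \<in> W; v \<in> W\<rbrakk> \<Longrightarrow> x \<notin> open_segment u v"
  shows "card W \<le> 2"
proof (rule ccontr)
  assume "\<not> card W \<le> 2"
  then have "3 \<le> card W" by simp
  then obtain Y where Y: "Y \<subseteq> W" "card Y = 3" by (meson obtain_subset_with_card_n)
  then obtain x y z where xyz: "Y = {x, y, z}" "x \<noteq> y" "y \<noteq> z" "x \<noteq> z" by (auto simp: card_3_iff)
  then have W: "x \<in> W" "y \<in> W" "z \<in> W" using Y by auto
  then have "a \<bullet> (z - x) = 0" "a \<bullet> (y - x) = 0" "y - x \<noteq> 0"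
    using a xyz by (auto simp: inner_diff_right)
  then obtain t where "z - x = t *\<^sub>R (y - x)" using plane_orthogonal_parallel[OF a(1)] by blast
  then have "z = x + t *\<^sub>R (y - x)" by (simp add: algebra_simps)
  then have "\<exists>c. w = x + c *\<^sub>R (y - x)" if "w \<in> {x, y, z}" for w
    using that by (metis add.right_neutral add_diff_cancel_left' diff_add_cancel empty_iff insert_iff
        scaleR_one scaleR_zero_left add.commute)
  then have "collinear {x, y, z}" unfolding collinear_alt by blast
  then have "between (y, z) x \<or> between (z, x) y \<or> between (x, y) z"
    by (simp only: collinear_between_cases)
  then have "x \<in> open_segment y z \<or> y \<in> open_segment z x \<or> z \<in> open_segment x y"
    using xyz by (auto simp: between_mem_segment open_segment_def)
  then show False using no W by blast
qed

lemma card_common_vertices_le_2: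
  fixes P :: "nat \<Rightarrow> (real^2) set"
  assumes part: "polytope_partition \<Omega> d P" and int: "\<forall>i\<in>{1..d}. interior (P i) \<noteq> {}"
    and ij: "i \<in> {1..d}" "j \<in> {1..d}" "i \<noteq> j"
    and V: "V = (\<Union>k\<in>{1..d}. {x. x extreme_point_of P k})"
  shows "card (V \<inter> P i \<inter> P j) \<le> 2"
proof -
  have poly: "\<forall>k\<in>{1..d}. polytope (P k)"
    and rel: "\<And>k l. \<lbrakk>k \<in> {1..d}; l \<in> {1..d}; k \<noteq> l\<rbrakk> \<Longrightarrow> rel_interior (P k) \<inter> rel_interior (P l) = {}"
    using part unfolding polytope_partition_def by auto
  have conv: "\<And>k. k \<in> {1..d} \<Longrightarrow> convex (P k)" using poly polytope_imp_convex by blast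
  have disj: "\<And>k l. \<lbrakk>k \<in> {1..d}; l \<in> {1..d}; k \<noteq> l\<rbrakk> \<Longrightarrow> interior (P k) \<inter> interior (P l) = {}"
    using rel int by (metis rel_interior_nonempty_interior)
  have "finite V" unfolding V using poly finite_extreme_points_polytope by auto
  then have fin: "finite (V \<inter> P i \<inter> P j)" by auto
  have "P i \<noteq> {}" "P j \<noteq> {}" using int ij interior_empty by metis+
  from separating_hyperplane_rel_interior_disjoint[OF conv[OF ij(1)] conv[OF ij(2)] this rel[OF ij]]
  obtain a b where a: "a \<noteq> 0" "\<forall>x\<in>P i. a \<bullet> x \<le> b" "\<forall>x\<in>P j. b \<le> a \<bullet> x" .
  have line: "\<forall>x\<in>V \<inter> P i \<inter> P j. a \<bullet> x = b" using a by force
  show ?thesis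
  proof (rule card_le_2_between[OF fin a(1) line])
    fix x u v
    assume x: "x \<in> V \<inter> P i \<inter> P j" and u: "u \<in> V \<inter> P i \<inter> P j" and v: "v \<in> V \<inter> P i \<inter> P j"
    obtain k where k: "k \<in> {1..d}" "x extreme_point_of P k" using x unfolding V by blast
    then have "x \<in> P k" unfolding extreme_point_of_def by simp
    show "x \<notin> open_segment u v"
    proof
      assume seg: "x \<in> open_segment u v"
      \<comment> \<open>An extreme point of \<open>P i\<close> or \<open>P j\<close> cannot lie
        inside a segment with both ends in that polytope, so \<open>x\<close> belongs to a third
        one.\<close>
      then have "k \<noteq> i" "k \<noteq> j" using k u v unfolding extreme_point_of_def by blast+
      then show False
        using no_point_inside_common_segment[of "P i" "P j" "P k" a b u v x] conv int ij k disj a u v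
          seg \<open>x \<in> P k\<close> by blast
    qed
  qed
qed

text \<open>Equality is stated for full-dimensional polytopes: a segment placed inside the common
  side of two polytopes satisfies the partition axioms, and its ends push the weight of that dual
  edge above 2. For \<open>d = 1\<close> the tree has no edges, so a single flat polytope is covered
  as well.\<close>

theorem theorem7:
  fixes \<Omega> :: "(real^2) set" and d :: nat and P S :: "nat \<Rightarrow> (real^2) set" and V :: "(real^2) set"
    and F1 :: "(real^2, 'u) formulation"
    and F2 :: "(real^2, nat \<times> (real^2)) formulation"
    and F3 :: "(real^2, 'w) formulation"
  assumes "1 \<le> d"
    and "bounded \<Omega>"
    and "polytope_partition \<Omega> d P"
    and "connected_partition d P"
    and "V = (\<Union>i\<in>{1..d}. {x. x extreme_point_of P i})"
    and "S = (\<lambda>i. V \<inter> P i)"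
    and "is_F1 d S F1"
    and "is_F2 d S F2"
    and "is_F3 d S F3"
  shows "num_cont F1 + 2 * (d - 1) \<le> num_cont F2
    \<and> num_cont F1 + 2 * (d - 1) \<le> num_cont F3
    \<and> (d = 1 \<or> (\<forall>i\<in>{1..d}. interior (P i) \<noteq> {}) \<longrightarrow>
         num_cont F1 + 2 * (d - 1) = num_cont F2
       \<and> num_cont F1 + 2 * (d - 1) = num_cont F3)"
proof -
  let ?w = "\<lambda>e. card (mid S e)"
  have poly: "\<And>i. i \<in> {1..d} \<Longrightarrow> polytope (P i)"
    and rel: "\<And>i j. \<lbrakk>i \<in> {1..d}; j \<in> {1..d}; i \<noteq> j\<rbrakk> \<Longrightarrow> rel_interior (P i) \<inter> rel_interior (P j) = {}"
    using assms(3) unfolding polytope_partition_def by auto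
  have finV: "finite V" unfolding assms(5)
    by (rule finite_UN_I) (use poly finite_extreme_points_polytope in blast)+
  have fin: "\<forall>i\<in>{1..d}. finite (S i)" unfolding assms(6) using finV by auto
  have mid: "mid S {i, j} = V \<inter> P i \<inter> P j" for i j unfolding mid_def assms(6) by auto
  obtain T where T: "max_spanning_tree {1..d} (complete_edges {1..d}) ?w T"
    and F1: "num_cont F1 + sum ?w T = (\<Sum>i\<in>{1..d}. card (S i))"
    using num_cont_F1[OF assms(7) fin assms(1)] .
  have F23: "num_cont F2 = (\<Sum>i\<in>{1..d}. card (S i))" "num_cont F3 = (\<Sum>i\<in>{1..d}. card (S i))"
    using num_cont_F2[OF assms(8) fin] num_cont_F3[OF assms(9) fin] .
  have "2 \<le> ?w e" if dual: "e \<in> dual_edges d P" for e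
  proof -
    obtain i j where ij: "e = {i, j}" "i \<in> {1..d}" "j \<in> {1..d}" "i \<noteq> j" "infinite (P i \<inter> P j)"
      using dual unfolding dual_edges_def by blast
    have "{x \<in> P i \<inter> P j. x extreme_point_of P i \<or> x extreme_point_of P j} \<subseteq> V \<inter> P i \<inter> P j"
      unfolding assms(5) using ij by blast
    then have "card {x \<in> P i \<inter> P j. x extreme_point_of P i \<or> x extreme_point_of P j} \<le> ?w e"
      unfolding ij(1) mid using finV by (intro card_mono) auto
    then show ?thesis
      using two_le_card_common_vertices[OF poly poly rel, of i j] ij by force
  qed
  moreover have "dual_edges d P \<subseteq> complete_edges {1..d}"
    unfolding dual_edges_def complete_edges_def by (auto simp: card_2_iff)
  moreover have "\<forall>e\<in>dual_edges d P. e \<subseteq> {1..d}" unfolding dual_edges_def by auto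
  ultimately have lower: "2 * (d - 1) \<le> sum ?w T"
    using max_spanning_tree_weight_ge[OF T, of "dual_edges d P" 2] assms(4)
    unfolding connected_partition_def by simp
  have tree: "graph_tree {1..d} T" "T \<subseteq> complete_edges {1..d}"
    using T unfolding max_spanning_tree_def spanning_tree_def by auto
  have cT: "card T = d - 1" using card_tree_edges[OF tree(1)] by simp
  have "sum ?w T \<le> 2 * (d - 1)" if full: "d = 1 \<or> (\<forall>i\<in>{1..d}. interior (P i) \<noteq> {})"
  proof -
    have "?w e \<le> 2" if e: "e \<in> T" for e
    proof -
      obtain i j where ij: "e = {i, j}" "i \<noteq> j" "i \<in> {1..d}" "j \<in> {1..d}"
        using e tree(2) unfolding complete_edges_def by (auto simp: card_2_iff)
      \<comment> \<open>An edge needs two vertices, so in the first case of \<open>full\<close>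
        there is nothing to bound.\<close>
      then have "d \<noteq> 1" by auto
      then show ?thesis
        using card_common_vertices_le_2[OF assms(3) _ ij(3,4,2) assms(5)] full unfolding ij(1) mid by blast
    qed
    then have "sum ?w T \<le> (\<Sum>e\<in>T. 2)" by (rule sum_mono)
    then show ?thesis using cT by simp
  qed
  then show ?thesis using lower F1 F23 by linarith
qed

end
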